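(* Let $m\in\mathbb N$, let $C\in\mathcal C_m$, and let $F\in\mathcal E_C$ be a proper exposed face of $C$. Then there exist $\dim(N_C(F))$ mutually distinct coatoms of $\mathcal E_C$ whose intersection is $F$ and whose normal cones are linearly independent exposed rays of $N_C(F)$.
   Context: $\mathbb R^m$ carries the standard inner product $\langle\cdot,\cdot\rangle$. The relative interior of a convex set is its interior in its affine hull. For a convex set $C\subset\mathbb R^m$ the normal cone of $C$ at $x\in C$ is $N_C(x):=\{u\in\mathbb R^m\mid \forall y\in C:\ \langle u,y-x\rangle\le 0\}$. For a non-empty convex subset $F\subset C$, $N_C(F):=N_C(x)$ for any relative interior point $x$ of $F$ (well-defined), and $N_C(\emptyset):=\mathbb R^m$. $\mathcal N_C$ denotes the set of normal cones of $C$ at points of $C$ together with $N_C(\emptyset)=\mathbb R^m$. A proper normal cone of $C$ is an element of $\mathcal N_C$ other than $N_C(\emptyset)$ and $N_C(C)$. An exposed face of a convex set is either the empty set or the set of minimizers of a linear form on it (the zero form is allowed, so the whole set is an exposed face). $\mathcal E_C$ is the set of exposed faces of $C$ ordered by inclusion. A proper exposed face of $C$ is an $F\in\mathcal E_C$ with $F\ne\emptyset$ and $F\ne C$. A coatom of $\mathcal E_C$ is an inclusion-maximal element of $\mathcal E_C\setminus\{C\}$. A ray is a set $\{\alpha u\mid\alpha\ge0\}$ with $u\neq0$; an exposed ray of a convex cone is an exposed face of it which is a ray. Rays are linearly independent if vectors spanning them are. A proper convex subset of $\mathbb R^m$ is a convex subset of $\mathbb R^m$ with interior points which has a proper exposed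 face. $\mathcal C_m$ is the class of proper convex subsets $C$ of $\mathbb R^m$ such that every proper normal cone $N$ of $C$ has $\dim(N)$ linearly independent exposed rays which are in $\mathcal N_C$. *)

theory Defs
  imports "HOL-Analysis.Analysis"
begin

section \<open>Exposed faces\<close>

text \<open>
  Exposed faces are those of the library's \<^const>\<open>exposed_face_of\<close>. The following lemma
  restates that notion, for a convex set, as: the empty set, or the set of minimizers of a
  (possibly zero) linear form.
\<close>

lemma exposed_face_of_iff_minimizers:
  fixes C :: "'a::euclidean_space set"
  assumes "convex C"
  shows "F exposed_face_of C \<longleftrightarrow> F = {} \<or> (\<exists>a. F = {x \<in> C. \<forall>y\<in>C. a \<bullet> x \<le> a \<bullet> y})"
proof
  assume "F exposed_face_of C"
  then obtain a b where ab: "C \<subseteq> {x. a \<bullet> x \<le> b}" "F = C \<inter> {x. a \<bullet> x = b}"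
    by (auto simp: exposed_face_of_def)
  show "F = {} \<or> (\<exists>a. F = {x \<in> C. \<forall>y\<in>C. a \<bullet> x \<le> a \<bullet> y})"
  proof (cases "F = {}")
    case False
    then obtain z where z: "z \<in> C" "a \<bullet> z = b" using ab by auto
    have "F = {x \<in> C. \<forall>y\<in>C. (- a) \<bullet> x \<le> (- a) \<bullet> y}"
      using ab z by (fastforce simp: inner_minus_left)
    then show ?thesis by blast
  qed simp
next
  assume *: "F = {} \<or> (\<exists>a. F = {x \<in> C. \<forall>y\<in>C. a \<bullet> x \<le> a \<bullet> y})"
  show "F exposed_face_of C"
  proof (cases "F = {}")
    case False
    with * obtain a where F: "F = {x \<in> C. \<forall>y\<in>C. a \<bullet> x \<le> a \<bullet> y}" by blast
    from False F obtain z where z: "z \<in> C" "\<forall>y\<in>C. a \<bullet> z \<le> a \<bullet> y" by blast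
    have "F = C \<inter> {x. a \<bullet> x = a \<bullet> z}"
    proof (intro set_eqI iffI)
      fix x assume "x \<in> F"
      then have "x \<in> C" "a \<bullet> x \<le> a \<bullet> z" using F z(1) by blast+
      then show "x \<in> C \<inter> {x. a \<bullet> x = a \<bullet> z}" using z(2) by (simp add: antisym)
    next
      fix x assume "x \<in> C \<inter> {x. a \<bullet> x = a \<bullet> z}"
      then show "x \<in> F" using F z(2) by simp
    qed
    then show ?thesis
      using exposed_face_of_Int_supporting_hyperplane_ge[OF assms] z by simp
  qed simp
qed

definition proper_exposed_face_of :: "'a::euclidean_space set \<Rightarrow> 'a set \<Rightarrow> bool" where
  "proper_exposed_face_of F C \<longleftrightarrow> F exposed_face_of C \<and> F \<noteq> {} \<and> F \<noteq> C"

definition exposed_face_coatoms :: "'a::euclidean_space set \<Rightarrow> 'a set set" where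
  "exposed_face_coatoms C =
    {F. F exposed_face_of C \<and> F \<noteq> C \<and>
        (\<forall>G. G exposed_face_of C \<and> G \<noteq> C \<and> F \<subseteq> G \<longrightarrow> G = F)}"

section \<open>Normal cones\<close>

definition normal_cone_at :: "'a::euclidean_space set \<Rightarrow> 'a \<Rightarrow> 'a set" where
  "normal_cone_at C x = {u. \<forall>y\<in>C. u \<bullet> (y - x) \<le> 0}"

definition normal_cone :: "'a::euclidean_space set \<Rightarrow> 'a set \<Rightarrow> 'a set" where
  "normal_cone C F =
    (if F = {} then UNIV else normal_cone_at C (SOME x. x \<in> rel_interior F))"

text \<open>The choice of the relative interior point does not matter.\<close>

lemma normal_cone_eq:
  assumes F: "convex F" "F \<subseteq> C" and x: "x \<in> rel_interior F"
  shows "normal_cone C F = normal_cone_at C x"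
proof -
  have *: "normal_cone_at C x \<subseteq> normal_cone_at C y"
    if x: "x \<in> rel_interior F" and y: "y \<in> rel_interior F" for x y
  proof
    fix u assume u: "u \<in> normal_cone_at C x"
    have "y \<in> affine hull F"
      using y rel_interior_subset by (metis hull_inc subsetD)
    then obtain e where e: "e > 1" "(1 - e) *\<^sub>R y + e *\<^sub>R x \<in> F"
      using convex_rel_interior_if[OF F(1) x] by (metis order_refl)
    have "(1 - e) *\<^sub>R y + e *\<^sub>R x \<in> C" using e(2) F(2) by blast
    then have "u \<bullet> ((1 - e) *\<^sub>R y + e *\<^sub>R x - x) \<le> 0"
      using u unfolding normal_cone_at_def by blast
    then have "(e - 1) * (u \<bullet> x - u \<bullet> y) \<le> 0"
      by (simp add: inner_simps algebra_simps)
    then have "u \<bullet> x \<le> u \<bullet> y"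
      using e(1) by (simp add: mult_le_0_iff)
    then show "u \<in> normal_cone_at C y"
      using u unfolding normal_cone_at_def
      by (simp add: inner_diff_right) (meson order_trans)
  qed
  have "(SOME x. x \<in> rel_interior F) \<in> rel_interior F"
    using x by (rule someI)
  moreover have "F \<noteq> {}" using x by auto
  ultimately show ?thesis
    using *[OF x] *[OF _ x] by (simp add: normal_cone_def subset_antisym)
qed

definition normal_cones :: "'a::euclidean_space set \<Rightarrow> 'a set set" where
  "normal_cones C = insert (normal_cone C {}) (normal_cone_at C ` C)"

definition proper_normal_cones :: "'a::euclidean_space set \<Rightarrow> 'a set set" where
  "proper_normal_cones C = normal_cones C - {normal_cone C {}, normal_cone C C}"

section \<open>Rays\<close>

definition ray :: "'a::real_vector \<Rightarrow> 'a set" where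
  "ray u = {\<alpha> *\<^sub>R u | \<alpha>. \<alpha> \<ge> 0}"

definition exposed_rays :: "'a::euclidean_space set \<Rightarrow> 'a set set" where
  "exposed_rays N = {R. R exposed_face_of N \<and> (\<exists>u. u \<noteq> 0 \<and> R = ray u)}"

text \<open>
  Spanning vectors of a ray are unique up to positive scaling, so it does not matter which ones
  are chosen. Members of an independent set are non-zero and span pairwise distinct rays.
\<close>

definition lin_indep_rays :: "'a::real_vector set set \<Rightarrow> bool" where
  "lin_indep_rays \<R> \<longleftrightarrow> (\<exists>B. independent B \<and> \<R> = ray ` B)"

section \<open>Classes of convex sets\<close>

definition proper_convex :: "'a::euclidean_space set \<Rightarrow> bool" where
  "proper_convex C \<longleftrightarrow> convex C \<and> interior C \<noteq> {} \<and> (\<exists>F. proper_exposed_face_of F C)"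

text \<open>
  Normal cones contain the origin, so their dimension (that of their affine hull) is the
  dimension \<^const>\<open>dim\<close> of their linear span.
\<close>

definition convex_class :: "'a::euclidean_space set set" where
  "convex_class =
    {C. proper_convex C \<and>
        (\<forall>N \<in> proper_normal_cones C.
           \<exists>\<R>. finite \<R> \<and> card \<R> = dim N \<and> \<R> \<subseteq> exposed_rays N \<inter> normal_cones C \<and>
               lin_indep_rays \<R>)}"

end

theory Submission
  imports Defs
begin

text \<open>
  A vector \<open>u\<close> is normal to \<open>C\<close> at \<open>x\<close> exactly if \<open>x\<close> lies in the exposed face where \<open>u\<close> is
  maximal on \<open>C\<close>, so normal cones and exposed faces determine each other and inclusions are
  reversed. Under this correspondence a ray \<open>ray u\<close> that is itself a normal cone belongs to a
  coatom, namely the face exposed by \<open>u\<close>: a larger proper exposed face would be exposed by a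
  non-zero vector of \<open>ray u\<close>, hence by \<open>u\<close> (\<open>exposed_by_ray_normal_cone\<close>).

  For a proper exposed face \<open>F\<close> of a set in the class, the normal cone \<open>N\<close> of \<open>F\<close> is proper
  (\<open>normal_cone_proper_exposed_face\<close>), so it has \<open>dim N\<close> linearly independent exposed rays that are
  normal cones. The sought coatoms are the faces exposed by these rays. They all contain \<open>F\<close>. For
  the converse inclusion, the chosen vectors span \<open>N\<close>, and each of them is constant on the
  intersection of the coatoms. Hence so is the vector of \<open>N\<close> that exposes \<open>F\<close>, and since the
  intersection meets \<open>F\<close>, it is contained in \<open>F\<close>.
\<close>

section \<open>Exposed faces and normal vectors\<close>

definition exposed_by :: "'a::euclidean_space set \<Rightarrow> 'a \<Rightarrow> 'a set" where
  "exposed_by C u = {x \<in> C. u \<in> normal_cone_at C x}"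

lemma exposed_by_eq_maximizers: "exposed_by C u = {x \<in> C. \<forall>y\<in>C. u \<bullet> y \<le> u \<bullet> x}"
  by (auto simp: exposed_by_def normal_cone_at_def inner_diff_right)

lemma exposed_face_of_imp_convex: "F exposed_face_of C \<Longrightarrow> convex F"
  by (auto simp: exposed_face_of_def intro: face_of_imp_convex)

lemma exposed_face_of_imp_subset: "F exposed_face_of C \<Longrightarrow> F \<subseteq> C"
  by (simp add: exposed_face_of_def face_of_imp_subset)

lemma exposed_by_exposed_face_of:
  assumes "convex C"
  shows "exposed_by C u exposed_face_of C"
proof -
  have "exposed_by C u = {x \<in> C. \<forall>y\<in>C. (- u) \<bullet> x \<le> (- u) \<bullet> y}"
    by (simp add: exposed_by_eq_maximizers)
  then show ?thesis
    unfolding exposed_face_of_iff_minimizers[OF assms] by blast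
qed

lemma exposed_face_of_exposed_by:
  assumes "convex C" "F exposed_face_of C" "F \<noteq> {}"
  obtains u where "F = exposed_by C u"
proof -
  obtain a where "F = {x \<in> C. \<forall>y\<in>C. a \<bullet> x \<le> a \<bullet> y}"
    using assms exposed_face_of_iff_minimizers by blast
  then have "F = exposed_by C (- a)"
    by (simp add: exposed_by_eq_maximizers)
  then show thesis by (rule that)
qed

lemma exposed_by_0 [simp]: "exposed_by C 0 = C"
  by (auto simp: exposed_by_eq_maximizers)

lemma exposed_by_scaleR:
  assumes "\<alpha> > 0"
  shows "exposed_by C (\<alpha> *\<^sub>R u) = exposed_by C u"
  using assms by (simp add: exposed_by_eq_maximizers)

text \<open>
  From a relative interior point of \<open>F\<close> one can move within \<open>F\<close> slightly away from any other point
  of \<open>F\<close>. A vector normal to \<open>C\<close> at the former is therefore constant on \<open>F\<close>.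
\<close>

lemma normal_cone_at_rel_interior_subset:
  assumes "convex F" "F \<subseteq> C" and x: "x \<in> rel_interior F" and y: "y \<in> F"
  shows "normal_cone_at C x \<subseteq> normal_cone_at C y"
proof
  fix u assume u: "u \<in> normal_cone_at C x"
  have "y \<in> affine hull F" using y by (rule hull_inc)
  then obtain e where e: "e > 1" "(1 - e) *\<^sub>R y + e *\<^sub>R x \<in> F"
    using convex_rel_interior_if[OF \<open>convex F\<close> x] by (metis order_refl)
  have "u \<bullet> ((1 - e) *\<^sub>R y + e *\<^sub>R x - x) \<le> 0"
    using u e(2) \<open>F \<subseteq> C\<close> unfolding normal_cone_at_def by blast
  then have "(e - 1) * (u \<bullet> x - u \<bullet> y) \<le> 0"
    by (simp add: inner_simps algebra_simps)
  then have "u \<bullet> x \<le> u \<bullet> y"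
    using e(1) by (simp add: mult_le_0_iff)
  then show "u \<in> normal_cone_at C y"
    using u unfolding normal_cone_at_def
    by (simp add: inner_diff_right) (meson order_trans)
qed

lemma normal_cone_at_interior:
  assumes "x \<in> interior C"
  shows "normal_cone_at C x = {0}"
proof
  show "normal_cone_at C x \<subseteq> {0}"
  proof
    fix u assume u: "u \<in> normal_cone_at C x"
    obtain e where e: "e > 0" "cball x e \<subseteq> C"
      using assms mem_interior_cball by blast
    have "x + (e / norm u) *\<^sub>R u \<in> cball x e"
      using e(1) by (simp add: dist_norm)
    then have "u \<bullet> ((e / norm u) *\<^sub>R u) \<le> 0"
      using u e(2) unfolding normal_cone_at_def by fastforce
    then have "e * norm u \<le> 0"
      by (simp add: dot_square_norm power2_eq_square split: if_splits)
    then show "u \<in> {0}"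
      using e(1) by (simp add: mult_le_0_iff)
  qed
qed (simp add: normal_cone_at_def)

lemma exposed_by_ne:
  assumes "interior C \<noteq> {}" "u \<noteq> 0"
  shows "exposed_by C u \<noteq> C"
proof
  assume *: "exposed_by C u = C"
  obtain x where x: "x \<in> interior C" using assms(1) by blast
  then have "x \<in> exposed_by C u" using * interior_subset by blast
  then show False
    using x assms(2) normal_cone_at_interior by (fastforce simp: exposed_by_def)
qed

section \<open>Coatoms and normal cones that are rays\<close>

lemma mem_ray: "u \<in> ray u"
  unfolding ray_def by (force intro: exI[of _ 1])

lemma ray_ne_UNIV:
  assumes "u \<noteq> 0"
  shows "ray u \<noteq> UNIV"
proof
  assume "ray u = UNIV"
  then have "- u \<in> ray u" by blast
  then obtain \<alpha> where \<alpha>: "\<alpha> \<ge> 0" "- u = \<alpha> *\<^sub>R u" unfolding ray_def by blast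
  from \<alpha>(2) have "(\<alpha> + 1) *\<^sub>R u = 0" by (simp add: algebra_simps flip: \<alpha>(2))
  then show False using \<alpha>(1) assms by simp
qed

text \<open>
  The point \<open>x\<close> can a priori lie on the relative boundary of the face \<open>G\<close> exposed by \<open>u\<close>. Still, the normal
  cone of \<open>G\<close> is the smallest one at points of \<open>G\<close>, so it is contained in \<open>ray u\<close>, and
  it contains \<open>u\<close> by the choice of \<open>G\<close>. An exposed face strictly between \<open>G\<close> and \<open>C\<close> is impossible
  because its exposing vector is normal to \<open>C\<close> on all of \<open>G\<close>, so that it is a positive multiple of \<open>u\<close>.
\<close>

lemma exposed_by_ray_normal_cone:
  assumes C: "convex C" "interior C \<noteq> {}"
    and x: "x \<in> C" "normal_cone_at C x = ray u" and "u \<noteq> 0"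
  shows "normal_cone C (exposed_by C u) = ray u"
    and "exposed_by C u \<in> exposed_face_coatoms C"
proof -
  define G where "G = exposed_by C u"
  have expo: "G exposed_face_of C"
    unfolding G_def using C(1) by (rule exposed_by_exposed_face_of)
  then have G: "convex G" "G \<subseteq> C"
    using exposed_face_of_imp_convex exposed_face_of_imp_subset by blast+
  have xG: "x \<in> G" unfolding G_def exposed_by_def using x mem_ray by auto
  then obtain z where z: "z \<in> rel_interior G"
    using G(1) rel_interior_eq_empty by blast
  have sub: "normal_cone_at C z \<subseteq> ray u"
    using normal_cone_at_rel_interior_subset[OF G z xG] x(2) by simp
  have zG: "z \<in> G" using z rel_interior_subset by blast
  then have "u \<in> normal_cone_at C z" by (simp add: G_def exposed_by_def)
  then have "ray u \<subseteq> normal_cone_at C z"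
    by (auto simp: ray_def normal_cone_at_def mult_nonneg_nonpos)
  with sub show "normal_cone C (exposed_by C u) = ray u"
    using normal_cone_eq[OF G z] unfolding G_def by simp
  have "H = G" if H: "H exposed_face_of C" "H \<noteq> C" "G \<subseteq> H" for H
  proof -
    obtain a where a: "H = exposed_by C a"
      using exposed_face_of_exposed_by[OF C(1) H(1)] xG H(3) by blast
    then have "a \<in> ray u"
      using zG H(3) sub by (auto simp: exposed_by_def)
    then obtain \<alpha> where \<alpha>: "\<alpha> \<ge> 0" "a = \<alpha> *\<^sub>R u" unfolding ray_def by blast
    have "\<alpha> \<noteq> 0" using a \<alpha>(2) H(2) by auto
    then show "H = G" using a \<alpha> exposed_by_scaleR[of \<alpha>] unfolding G_def by simp
  qed
  then show "exposed_by C u \<in> exposed_face_coatoms C"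
    using expo exposed_by_ne[OF C(2) \<open>u \<noteq> 0\<close>]
    unfolding exposed_face_coatoms_def G_def by blast
qed

section \<open>Faces as intersections of coatoms\<close>

text \<open>
  The normal cone of \<open>C\<close> itself is \<open>{0}\<close> as \<open>C\<close> has interior points, whereas a vector exposing \<open>F\<close> is
  non-zero. If every vector were normal to \<open>C\<close> at a point of \<open>F\<close>, then \<open>C\<close> would be that point
  and equal to \<open>F\<close>.
\<close>

lemma normal_cone_proper_exposed_face:
  assumes C: "convex C" "interior C \<noteq> {}" and F: "proper_exposed_face_of F C"
  shows "normal_cone C F \<in> proper_normal_cones C"
proof -
  have expo: "F exposed_face_of C" "F \<noteq> {}" "F \<noteq> C"
    using F by (auto simp: proper_exposed_face_of_def)
  then have cF: "convex F" "F \<subseteq> C"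
    using exposed_face_of_imp_convex exposed_face_of_imp_subset by blast+
  obtain x where x: "x \<in> rel_interior F"
    using cF(1) expo(2) rel_interior_eq_empty by blast
  then have xF: "x \<in> F" using rel_interior_subset by blast
  have N: "normal_cone C F = normal_cone_at C x"
    using cF x by (rule normal_cone_eq)
  have "normal_cone_at C x \<noteq> UNIV"
  proof
    assume "normal_cone_at C x = UNIV"
    then have "(y - x) \<bullet> (y - x) \<le> 0" if "y \<in> C" for y
      using that unfolding normal_cone_at_def by blast
    then have "(y - x) \<bullet> (y - x) = 0" if "y \<in> C" for y
      using that inner_ge_zero antisym by blast
    then have "C \<subseteq> {x}" by auto
    then show False using xF cF(2) expo(3) by blast
  qed
  moreover have "normal_cone C C = {0}"
  proof -
    obtain z where z: "z \<in> interior C" using C(2) by blast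
    then have "z \<in> rel_interior C" using interior_subset_rel_interior by blast
    then show ?thesis
      using normal_cone_eq[OF C(1) order_refl] normal_cone_at_interior[OF z] by simp
  qed
  moreover have "normal_cone_at C x \<noteq> {0}"
  proof
    assume 0: "normal_cone_at C x = {0}"
    obtain a where a: "F = exposed_by C a"
      using exposed_face_of_exposed_by[OF C(1) expo(1,2)] .
    then have "a = 0" using 0 xF by (auto simp: exposed_by_def)
    then show False using a expo(3) by simp
  qed
  ultimately show ?thesis
    using N xF cF(2) by (auto simp: proper_normal_cones_def normal_cones_def normal_cone_def)
qed

text \<open>
  A vector of \<open>B\<close> attains its maximum over \<open>C\<close> both on \<open>F\<close> and on the intersection. Differences of
  points of these two sets are thus orthogonal to \<open>span B\<close>, which contains a vector exposing \<open>F\<close>.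
\<close>

lemma Inter_exposed_by_spanning:
  assumes F: "convex C" "F exposed_face_of C" "F \<noteq> {}" "F \<noteq> C"
    and B: "B \<subseteq> normal_cone C F" "normal_cone C F \<subseteq> span B"
  shows "(\<Inter>u\<in>B. exposed_by C u) = F"
proof -
  have cF: "convex F" "F \<subseteq> C"
    using F exposed_face_of_imp_convex exposed_face_of_imp_subset by blast+
  obtain x where x: "x \<in> rel_interior F"
    using cF(1) F(3) rel_interior_eq_empty by blast
  then have xF: "x \<in> F" using rel_interior_subset by blast
  have N: "normal_cone C F = normal_cone_at C x"
    using cF x by (rule normal_cone_eq)
  have sub: "F \<subseteq> exposed_by C u" if "u \<in> B" for u
    using normal_cone_at_rel_interior_subset[OF cF x] that B(1) cF(2)
    unfolding N exposed_by_def by blast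
  obtain a where a: "F = exposed_by C a"
    using exposed_face_of_exposed_by[OF F(1-3)] .
  have "a \<in> span B" using xF B(2) N a by (auto simp: exposed_by_def)
  have "B \<noteq> {}" using \<open>a \<in> span B\<close> a \<open>F \<noteq> C\<close> by auto
  have "y \<in> F" if y: "y \<in> (\<Inter>u\<in>B. exposed_by C u)" for y
  proof -
    have yC: "y \<in> C" using y \<open>B \<noteq> {}\<close> by (auto simp: exposed_by_def)
    have "u \<bullet> (y - x) = 0" if u: "u \<in> B" for u
    proof -
      have "x \<in> exposed_by C u" "y \<in> exposed_by C u" using sub[OF u] xF y u by blast+
      then have "u \<bullet> x = u \<bullet> y"
        unfolding exposed_by_eq_maximizers by (auto intro: antisym)
      then show ?thesis by (simp add: inner_diff_right)
    qed
    then have "orthogonal (y - x) u" if "u \<in> B" for u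
      using that by (simp add: orthogonal_def inner_commute)
    then have "orthogonal (y - x) a"
      by (rule orthogonal_to_span[OF \<open>a \<in> span B\<close>])
    then have "a \<bullet> y = a \<bullet> x"
      by (simp add: orthogonal_def inner_diff_left inner_commute[of a])
    then show "y \<in> F"
      using xF yC unfolding a exposed_by_eq_maximizers by simp
  qed
  then show ?thesis using sub by blast
qed

theorem corollary2p3:
  fixes C F :: "(real ^ 'm) set"
  assumes "C \<in> convex_class"
    and "proper_exposed_face_of F C"
  shows "\<exists>\<K>. finite \<K> \<and> card \<K> = dim (normal_cone C F) \<and>
           \<K> \<subseteq> exposed_face_coatoms C \<and>
           \<Inter>\<K> = F \<and>
           inj_on (normal_cone C) \<K> \<and>
           normal_cone C ` \<K> \<subseteq> exposed_rays (normal_cone C F) \<and>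
           lin_indep_rays (normal_cone C ` \<K>)"
proof -
  define N where "N = normal_cone C F"
  have C: "convex C" "interior C \<noteq> {}"
    using assms(1) by (auto simp: convex_class_def proper_convex_def)
  have F: "F exposed_face_of C" "F \<noteq> {}" "F \<noteq> C"
    using assms(2) by (auto simp: proper_exposed_face_of_def)
  have "N \<in> proper_normal_cones C"
    unfolding N_def using C assms(2) by (rule normal_cone_proper_exposed_face)
  then obtain \<R> where \<R>: "finite \<R>" "card \<R> = dim N" "\<R> \<subseteq> exposed_rays N"
      "\<R> \<subseteq> normal_cones C" "lin_indep_rays \<R>"
    using assms(1) unfolding convex_class_def by blast
  then obtain B where B: "independent B" "\<R> = ray ` B"
    unfolding lin_indep_rays_def by blast
  have finB: "finite B" using B(1) by (rule independent_imp_finite)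
  have BN: "B \<subseteq> N"
  proof
    fix u assume u: "u \<in> B"
    then have "ray u exposed_face_of N" using B(2) \<R>(3) by (auto simp: exposed_rays_def)
    then show "u \<in> N" using exposed_face_of_imp_subset mem_ray by blast
  qed
  have "card B \<ge> dim N" using card_image_le[OF finB, of ray] \<R>(2) B(2) by simp
  then have span: "N \<subseteq> span B" using BN B(1) card_ge_dim_independent by blast
  have ray: "normal_cone C (exposed_by C u) = ray u" "exposed_by C u \<in> exposed_face_coatoms C"
    if u: "u \<in> B" for u
  proof -
    have "u \<noteq> 0" using u B(1) dependent_zero by blast
    moreover have "ray u \<in> normal_cones C" using u B(2) \<R>(4) by blast
    then obtain x where "x \<in> C" "normal_cone_at C x = ray u"
      using ray_ne_UNIV[OF \<open>u \<noteq> 0\<close>] by (auto simp: normal_cones_def normal_cone_def)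
    ultimately show "normal_cone C (exposed_by C u) = ray u"
        "exposed_by C u \<in> exposed_face_coatoms C"
      using exposed_by_ray_normal_cone[OF C] by blast+
  qed
  define \<K> where "\<K> = exposed_by C ` B"
  have image: "normal_cone C ` \<K> = \<R>"
    unfolding \<K>_def B(2) image_image using ray(1) by simp
  have finK: "finite \<K>" unfolding \<K>_def using finB by simp
  \<comment> \<open>Both \<open>exposed_by C\<close> and \<open>normal_cone C\<close> are injective here, since the composite of their
    restrictions maps \<open>B\<close>, with at most \<open>dim N\<close> elements, onto the \<open>dim N\<close> rays of \<open>\<R>\<close>.\<close>
  have "card \<K> \<le> card B" unfolding \<K>_def using finB by (rule card_image_le)
  also have "card B \<le> dim N" using independent_card_le_dim[OF BN B(1)] .
  finally have "card \<K> \<le> card (normal_cone C ` \<K>)" using image \<R>(2) by simp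
  then have card: "card (normal_cone C ` \<K>) = card \<K>"
    using card_image_le[OF finK, of "normal_cone C"] by (rule le_antisym[rotated])
  moreover have "\<Inter>\<K> = F"
    unfolding \<K>_def
    using Inter_exposed_by_spanning[OF C(1) F] BN span unfolding N_def .
  moreover have "\<K> \<subseteq> exposed_face_coatoms C"
    unfolding \<K>_def using ray(2) by blast
  ultimately show ?thesis
    using finK image \<R> eq_card_imp_inj_on[OF finK card] unfolding N_def
    by (intro exI[of _ \<K>]) simp
qed

end
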